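(* Let $E$ be a Dedekind complete Riesz space with weak order unit $e$, and let $T$ be a conditional expectation operator on $E$ with $Te=e$. If $f,g,fg\in E$ with $g\in\mathcal{R}(T)$, then $g\cdot Tf\in E$ and $T(fg)=g\cdot Tf$.
   Context: A conditional expectation operator on a Dedekind complete Riesz space $E$ with weak order unit is a positive order continuous projection $T:E\to E$ whose range $\mathcal{R}(T)$ is a Dedekind complete Riesz subspace of $E$ and such that $Te$ is a weak order unit of $E$ for each weak order unit $e$ of $E$. The universal completion $E^u$ of $E$ carries its natural $f$-algebra multiplication with multiplicative unit $e$, determined by $(Pe)\cdot(Qe)=PQe$ for band projections $P,Q$. Products of elements of $E$ are taken in $E^u$ and need not lie in $E$. *)

theory Defs
  imports Complex_Main "HOL-Library.Lattice_Algebras" "HOL-Library.Lub_Glb"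
begin

section \<open>Riesz spaces\<close>

class riesz_space = ordered_real_vector + lattice_ab_group_add_abs

class dedekind_complete_riesz_space = riesz_space + conditionally_complete_lattice

text \<open>Universally complete means Dedekind complete and laterally complete. The set \<open>A\<close> is
  required to be nonempty because the empty set has no supremum in a nonzero Riesz space.\<close>

class universally_complete_riesz_space = dedekind_complete_riesz_space +
  assumes laterally_complete:
    "A \<noteq> {} \<Longrightarrow> (\<forall>x\<in>A. 0 \<le> x) \<Longrightarrow> (\<forall>x\<in>A. \<forall>y\<in>A. x \<noteq> y \<longrightarrow> inf x y = 0) 
      \<Longrightarrow> \<exists>s. (\<forall>x\<in>A. x \<le> s) \<and> (\<forall>u. (\<forall>x\<in>A. x \<le> u) \<longrightarrow> s \<le> u)"

text \<open>Multiplication is the one of \<^class>\<open>real_algebra\<close>, that is, bilinear and associative; no unit is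
  required here, so that the zero space is not excluded.\<close>

class f_algebra = riesz_space + lattice_ring + real_algebra +
  assumes f_algebra_right: "inf x y = 0 \<Longrightarrow> 0 \<le> z \<Longrightarrow> inf (x * z) y = 0"
    and f_algebra_left: "inf x y = 0 \<Longrightarrow> 0 \<le> z \<Longrightarrow> inf (z * x) y = 0"

definition riesz_subspace :: "'a::riesz_space set \<Rightarrow> bool" where
  "riesz_subspace S \<longleftrightarrow> subspace S \<and> (\<forall>x\<in>S. \<forall>y\<in>S. sup x y \<in> S \<and> inf x y \<in> S)"

text \<open>Suprema are taken in \<open>S\<close> with its induced order, not in the surrounding space.\<close>

definition dedekind_complete_on :: "'a::order set \<Rightarrow> bool" where
  "dedekind_complete_on S \<longleftrightarrow>
     (\<forall>A. A \<subseteq> S \<and> A \<noteq> {} \<and> (\<exists>u. isUb S A u) \<longrightarrow> (\<exists>s. isLub S A s))"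

section \<open>Bands, band projections and weak order units\<close>

definition band :: "'a::riesz_space set \<Rightarrow> bool" where
  "band B \<longleftrightarrow> subspace B
     \<and> (\<forall>x\<in>B. \<forall>y. \<bar>y\<bar> \<le> \<bar>x\<bar> \<longrightarrow> y \<in> B)
     \<and> (\<forall>A s. A \<subseteq> B \<and> isLub UNIV A s \<longrightarrow> s \<in> B)"

definition disjoint_complement :: "'a::riesz_space set \<Rightarrow> 'a set" where
  "disjoint_complement B = {x. \<forall>y\<in>B. inf \<bar>x\<bar> \<bar>y\<bar> = 0}"

text \<open>\<open>P\<close> is the projection onto some band \<open>B\<close> along its disjoint complement.\<close>

definition band_projection :: "('a::riesz_space \<Rightarrow> 'a) \<Rightarrow> bool" where
  "band_projection P \<longleftrightarrow>
     (\<exists>B. band B \<and> (\<forall>x. P x \<in> B \<and> x - P x \<in> disjoint_complement B))"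

definition weak_order_unit :: "'a::riesz_space \<Rightarrow> bool" where
  "weak_order_unit e \<longleftrightarrow> 0 \<le> e \<and> band hull {e} = UNIV"

section \<open>Conditional expectation operators\<close>

definition positive_operator :: "('a::riesz_space \<Rightarrow> 'a) \<Rightarrow> bool" where
  "positive_operator T \<longleftrightarrow> linear T \<and> (\<forall>x. 0 \<le> x \<longrightarrow> 0 \<le> T x)"

text \<open>\<open>D \<down> 0\<close>: the set \<open>D\<close> is downward directed with infimum \<open>0\<close>.\<close>

definition decreases_to_zero :: "'a::riesz_space set \<Rightarrow> bool" where
  "decreases_to_zero D \<longleftrightarrow> D \<noteq> {} \<and> (\<forall>x\<in>D. \<forall>y\<in>D. \<exists>z\<in>D. z \<le> x \<and> z \<le> y) \<and> isGlb UNIV D 0"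

text \<open>Order continuity in the form used for positive operators: \<open>D \<down> 0\<close> implies \<open>T D \<down> 0\<close>.\<close>

definition positive_order_continuous :: "('a::riesz_space \<Rightarrow> 'a) \<Rightarrow> bool" where
  "positive_order_continuous T \<longleftrightarrow>
     positive_operator T \<and> (\<forall>D. decreases_to_zero D \<longrightarrow> decreases_to_zero (T ` D))"

definition conditional_expectation :: "('a::dedekind_complete_riesz_space \<Rightarrow> 'a) \<Rightarrow> bool" where
  "conditional_expectation T \<longleftrightarrow>
     positive_order_continuous T
     \<and> (\<forall>x. T (T x) = T x)
     \<and> riesz_subspace (range T) \<and> dedekind_complete_on (range T)
     \<and> (\<forall>w. weak_order_unit w \<longrightarrow> weak_order_unit (T w))"

section \<open>Universal completion and its multiplication\<close>

text \<open>\<open>J\<close> identifies the space with an order dense Riesz subspace of a universally complete space.\<close>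

definition universal_completion ::
    "('a::riesz_space \<Rightarrow> 'u::universally_complete_riesz_space) \<Rightarrow> bool" where
  "universal_completion J \<longleftrightarrow>
     linear J \<and> inj J
     \<and> (\<forall>x y. J (sup x y) = sup (J x) (J y) \<and> J (inf x y) = inf (J x) (J y))
     \<and> (\<forall>u>0. \<exists>x. 0 < J x \<and> J x \<le> u)"

text \<open>The \<open>f\<close>-algebra multiplication of the type is the natural one associated with \<open>e\<close>: it has
  \<open>e\<close> as unit, and components of \<open>e\<close> multiply like the corresponding band projections.\<close>

definition natural_multiplication ::
    "'u::{universally_complete_riesz_space, f_algebra} \<Rightarrow> bool" where
  "natural_multiplication e \<longleftrightarrow>
     (\<forall>x. e * x = x \<and> x * e = x)
     \<and> (\<forall>P Q. band_projection P \<and> band_projection Q \<longrightarrow> P e * Q e = P (Q e))"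

end

theory Submission
  imports Defs
begin

text \<open>
  By linearity, and because the order dense, Dedekind complete space \<open>J E\<close> is an ideal of the
  universal completion (\<open>universal_completion_range_ideal\<close>), the identity reduces to \<open>f, g \<ge> 0\<close>.
  For such \<open>f\<close> and \<open>g\<close> the two sides are compared through their position relative to multiples of
  \<open>T f\<close>. Reading elements as functions, \<open>a \<le> c T f\<close> holds where \<open>g < c\<close>, and \<open>a \<ge> c T f\<close> where
  \<open>g > c\<close>, for every real \<open>c\<close>, both for \<open>a = g \<cdot> T f\<close> and for \<open>a = T (f g)\<close>. Only one \<open>a\<close> has this property, namely \<open>g \<cdot> T f\<close>.

  That \<open>T (f g)\<close> has the property rests on two facts. First,
  \<open>T (f g) - c T f = T (f (g - c e))\<close>, and since \<open>f \<ge> 0\<close> multiplication by \<open>f\<close> commutes with taking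
  positive parts in an f-algebra; so the positive part of \<open>f (g - c e)\<close> is disjoint from the negative
  part of \<open>g - c e\<close>. Second, \<open>T\<close> is local over its range: if \<open>x\<close> is disjoint from \<open>y \<in> R(T)\<close>, then
  so is \<open>T x\<close> (\<open>conditional_expectation_local\<close>). This applies because \<open>g - c e \<in> R(T)\<close>.

  Uniqueness (\<open>le_if_level_sets_compatible\<close>) is an Archimedean argument: for two such elements
  \<open>a, a'\<close> and \<open>\<epsilon> > 0\<close>, induction on \<open>k\<close> shows that \<open>a \<le> a' + 2 \<epsilon> T f\<close> holds on the part where
  \<open>g < k \<epsilon>\<close>.
\<close>

section \<open>Disjoint elements and positive parts\<close>

lemma inf_add_le:
  fixes x y z :: "'a::riesz_space"
  assumes "0 \<le> x" "0 \<le> y" "0 \<le> z"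
  shows "inf z (x + y) \<le> inf z x + inf z y"
proof -
  let ?w = "inf z (x + y)"
  have wz: "?w \<le> z" and wxy: "?w \<le> x + y" by auto
  have "?w - x \<le> inf z y"
  proof (rule le_infI)
    show "?w - x \<le> z" using wz assms(1) by (simp add: diff_le_eq add_increasing2)
    show "?w - x \<le> y" using wxy by (simp add: diff_le_eq add.commute)
  qed
  then have 1: "?w - inf z y \<le> x" by (simp only: diff_le_eq add.commute)
  have "0 \<le> inf z y" using assms by auto
  then have 2: "?w - inf z y \<le> z" using add_mono[OF wz, of 0] by (simp only: diff_le_eq add_0_right)
  show ?thesis using le_infI[OF 2 1] by (simp only: diff_le_eq)
qed

lemma disjoint_mono:
  fixes x y z :: "'a::riesz_space"
  assumes "inf x y = 0" "0 \<le> z" "z \<le> x"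
  shows "inf z y = 0"
proof (rule antisym)
  show "inf z y \<le> 0" using inf_mono[OF assms(3) order_refl[of y]] assms(1) by simp
  show "0 \<le> inf z y" using assms(1,2) inf_le2[of x y] by simp
qed

lemma disjoint_add:
  fixes x y z :: "'a::riesz_space"
  assumes "inf x z = 0" "inf y z = 0"
  shows "inf (x + y) z = 0"
proof (rule antisym)
  have nn: "0 \<le> x" "0 \<le> y" "0 \<le> z"
    using inf_le1[of x z] inf_le1[of y z] inf_le2[of x z] assms by simp_all
  show "inf (x + y) z \<le> 0"
    using inf_add_le[OF nn] assms by (simp add: inf.commute)
  show "0 \<le> inf (x + y) z" using nn by simp
qed

text \<open>A lower bound of \<open>r x\<close> and \<open>y\<close> lies below \<open>m x\<close> and \<open>m y\<close> for \<open>m = max r 1\<close>; divide by \<open>m\<close>.\<close>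

lemma disjoint_scaleR:
  fixes x y :: "'a::riesz_space"
  assumes "inf x y = 0" "0 \<le> r"
  shows "inf (r *\<^sub>R x) y = 0"
proof (rule antisym)
  have nn: "0 \<le> x" "0 \<le> y"
    using inf_le1[of x y] inf_le2[of x y] assms by simp_all
  define m where "m = max r 1"
  have m: "m > 0" "r \<le> m" "1 \<le> m" by (auto simp: m_def)
  let ?z = "inf (r *\<^sub>R x) y"
  have "?z \<le> m *\<^sub>R x"
    by (rule order_trans[OF inf_le1]) (rule scaleR_right_mono[OF m(2) nn(1)])
  then have 1: "?z /\<^sub>R m \<le> x" using m(1) by (simp add: pos_divideR_le_eq)
  have "y \<le> m *\<^sub>R y" using scaleR_right_mono[OF m(3) nn(2)] by simp
  then have "?z \<le> m *\<^sub>R y" by (rule order_trans[OF inf_le2])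
  then have 2: "?z /\<^sub>R m \<le> y" using m(1) by (simp add: pos_divideR_le_eq)
  have "?z /\<^sub>R m \<le> 0" using le_infI[OF 1 2] assms(1) by simp
  then show "?z \<le> 0" using m(1) by (simp add: pos_divideR_le_eq)
  show "0 \<le> ?z" using nn assms(2) by (simp add: scaleR_nonneg_nonneg)
qed

lemma pprt_diff_pprt_uminus:
  fixes x :: "'a::riesz_space"
  shows "pprt x - pprt (- x) = x"
  by (simp only: pprt_neg diff_minus_eq_add flip: prts)

lemma disjoint_pprt_uminus:
  fixes x :: "'a::riesz_space"
  shows "inf (pprt x) (pprt (- x)) = 0"
proof -
  have "inf (pprt x) (pprt (- x)) = inf (x + pprt (- x)) (0 + pprt (- x))"
    using pprt_diff_pprt_uminus[of x] by (simp add: diff_eq_eq)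
  also have "\<dots> = inf x 0 + pprt (- x)" by (simp only: add_inf_distrib_right)
  also have "\<dots> = 0" by (simp only: pprt_neg nprt_def right_minus)
  finally show ?thesis .
qed

lemma pprt_diff_disjoint:
  fixes p q :: "'a::riesz_space"
  assumes "inf p q = 0"
  shows "pprt (p - q) = p"
proof -
  have "sup (p - q) (q - q) = sup p q - q"
    using add_sup_distrib_right[of p q "- q"] by simp
  also have "sup p q = p + q" using add_eq_inf_sup[of p q] assms by (simp only: add_0_right)
  also have "p + q - q = p" by simp
  finally show ?thesis by (simp only: pprt_def diff_self)
qed

lemma pprt_add_le:
  fixes x y :: "'a::riesz_space"
  shows "pprt (x + y) \<le> pprt x + pprt y"
  unfolding pprt_def by (rule sup_least) (auto intro: add_mono)

lemma le_pprt: "(x::'a::riesz_space) \<le> pprt x"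
  by (simp add: pprt_def)

lemma pprt_le_abs: "pprt x \<le> \<bar>x::'a::riesz_space\<bar>"
  by (simp add: pprt_def abs_ge_self)

lemma riesz_subspace_pprt:
  assumes "riesz_subspace S" "x \<in> S"
  shows "pprt x \<in> S"
proof -
  have "0 \<in> S" using assms(1) subspace_0 by (auto simp: riesz_subspace_def)
  then show ?thesis using assms by (simp add: riesz_subspace_def pprt_def)
qed

section \<open>Truncation and the Archimedean property\<close>

text \<open>Pointwise: where \<open>a - n b\<close> is positive, \<open>b\<close> lies below \<open>a / n\<close>. Everywhere \<open>n b\<close> exceeds \<open>a\<close> by
  at most \<open>pprt (n b - a)\<close>, and this excess is disjoint from \<open>pprt (a - n b)\<close>. Together with
  the Archimedean property the bound makes such truncations vanish as \<open>n\<close> grows.\<close>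

lemma scaleR_inf_pprt_le:
  fixes a b :: "'a::riesz_space"
  assumes "0 \<le> a" "0 \<le> b" "0 \<le> n"
  shows "n *\<^sub>R inf (pprt (a - n *\<^sub>R b)) b \<le> a"
proof -
  let ?p = "pprt (a - n *\<^sub>R b)" and ?q = "pprt (n *\<^sub>R b - a)"
  have "inf ?p ?q = 0" using disjoint_pprt_uminus[of "a - n *\<^sub>R b"] by simp
  then have disj: "inf (n *\<^sub>R ?p) ?q = 0" using assms(3) by (rule disjoint_scaleR)
  have 1: "n *\<^sub>R inf ?p b \<le> n *\<^sub>R ?p" using assms(3) by (simp add: scaleR_left_mono)
  have "n *\<^sub>R inf ?p b \<le> n *\<^sub>R b" using assms(3) by (simp add: scaleR_left_mono)
  also have "\<dots> \<le> a + ?q" using le_pprt[of "n *\<^sub>R b - a"] by (simp add: diff_le_eq add.commute)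
  finally have "n *\<^sub>R inf ?p b \<le> inf (n *\<^sub>R ?p) (a + ?q)" using 1 by simp
  also have "\<dots> \<le> inf (n *\<^sub>R ?p) a + inf (n *\<^sub>R ?p) ?q"
    using assms by (intro inf_add_le) (auto simp: scaleR_nonneg_nonneg)
  also have "\<dots> \<le> a" using disj by simp
  finally show ?thesis .
qed

text \<open>If \<open>s\<close> is the supremum of all \<open>n x\<close>, then \<open>s - x\<close> is an upper bound of them as well.\<close>

lemma archimedean:
  fixes x y :: "'a::dedekind_complete_riesz_space"
  assumes "\<And>n::nat. real n *\<^sub>R x \<le> y"
  shows "x \<le> 0"
proof -
  let ?s = "SUP n::nat. real n *\<^sub>R x"
  have bdd: "bdd_above (range (\<lambda>n::nat. real n *\<^sub>R x))"
    using assms by (intro bdd_aboveI[of _ y]) auto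
  have "?s \<le> ?s - x"
  proof (rule cSUP_least)
    fix n :: nat
    have "real (Suc n) *\<^sub>R x \<le> ?s" using bdd by (rule cSUP_upper[OF UNIV_I])
    then show "real n *\<^sub>R x \<le> ?s - x" by (simp add: scaleR_left_distrib le_diff_eq add.commute)
  qed simp
  then show ?thesis by (simp add: le_diff_eq)
qed

lemma le_zero_if_le_scaleR:
  fixes x y :: "'a::dedekind_complete_riesz_space"
  assumes "0 \<le> y" "\<And>r. r > 0 \<Longrightarrow> x \<le> r *\<^sub>R y"
  shows "x \<le> 0"
proof (rule archimedean)
  fix n :: nat
  show "real n *\<^sub>R x \<le> y"
  proof (cases "n = 0")
    case False
    then show ?thesis
      using scaleR_left_mono[OF assms(2)[of "1 / real n"], of "real n"] by simp
  qed (use assms in simp)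
qed

section \<open>Weak order units\<close>

text \<open>Weak order units are defined through the band that they generate. That complements of single
  elements are bands turns this into the usable form: only \<open>0\<close> is disjoint from a weak order unit.
  For closure under suprema, let \<open>t\<close> be the meet of \<open>pprt s\<close> with \<open>\<bar>z\<bar>\<close>. It is disjoint from each
  \<open>pprt a\<close>, so \<open>pprt a\<close> and \<open>t\<close> fit below \<open>pprt s\<close> together, and \<open>pprt s - t\<close> is still an upper
  bound.\<close>

lemma disjoint_complement_singleton_band:
  fixes z :: "'a::riesz_space"
  shows "band (disjoint_complement {z})"
proof -
  let ?B = "{x. inf \<bar>x\<bar> \<bar>z\<bar> = 0}"
  have solid: "inf \<bar>y\<bar> \<bar>z\<bar> = 0" if "inf \<bar>x\<bar> \<bar>z\<bar> = 0" "\<bar>y\<bar> \<le> \<bar>x\<bar>" for x y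
    using that by (blast intro: disjoint_mono abs_ge_zero)
  have "subspace ?B"
  proof (rule subspaceI)
    show "x + y \<in> ?B" if "x \<in> ?B" "y \<in> ?B" for x y
      using disjoint_mono[OF disjoint_add _ abs_triangle_ineq, of x "\<bar>z\<bar>" y] that by simp
    show "r *\<^sub>R x \<in> ?B" if "x \<in> ?B" for r x
    proof -
      have le: "r *\<^sub>R y \<le> \<bar>r\<bar> *\<^sub>R \<bar>y\<bar>" for r and y :: 'a
        using abs_ge_self[of y] abs_ge_minus_self[of y]
          scaleR_left_mono[of y "\<bar>y\<bar>" r] scaleR_left_mono[of "- y" "\<bar>y\<bar>" "- r"]
        by (cases "0 \<le> r") auto
      have "\<bar>r *\<^sub>R x\<bar> \<le> \<bar>r\<bar> *\<^sub>R \<bar>x\<bar>"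
        using le[of r x] le[of "- r" x] by (auto intro: abs_leI)
      moreover have "inf (\<bar>r\<bar> *\<^sub>R \<bar>x\<bar>) \<bar>z\<bar> = 0"
        using that by (intro disjoint_scaleR) auto
      ultimately show ?thesis by (auto intro: disjoint_mono)
    qed
  qed (simp add: inf_absorb1)
  moreover have "s \<in> ?B" if A: "A \<subseteq> ?B" and s: "isLub UNIV A s" for A s
  proof -
    have ub: "a \<le> s" if "a \<in> A" for a
      using s that by (auto simp: isLub_def leastP_def isUb_def setle_def)
    have least: "s \<le> u" if "\<And>a. a \<in> A \<Longrightarrow> a \<le> u" for u
      using s that by (auto simp: isLub_def leastP_def isUb_def setle_def setge_def)
    show ?thesis
    proof (cases "A = {}")
      case True
      \<comment> \<open>A least upper bound of the empty set is a least element of the whole space.\<close>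
      then have "s \<le> 0" "s \<le> s + s" by (intro least; simp)+
      then have "s = 0" by (intro antisym) simp_all
      then show ?thesis by (simp add: inf_absorb1)
    next
      case False
      then obtain a where a: "a \<in> A" by auto
      let ?t = "inf (pprt s) \<bar>z\<bar>"
      have "s \<le> pprt s - ?t"
      proof (rule least)
        fix a assume a: "a \<in> A"
        have "inf \<bar>a\<bar> \<bar>z\<bar> = 0" using A a by blast
        then have "inf (pprt a) \<bar>z\<bar> = 0" by (rule disjoint_mono[OF _ _ pprt_le_abs]) simp
        then have "inf (pprt a) ?t = 0"
          using disjoint_mono[of "\<bar>z\<bar>" "pprt a" ?t] by (simp add: inf.commute)
        then have "pprt a + ?t = sup (pprt a) ?t" using add_eq_inf_sup[of "pprt a" ?t] by simp
        also have "\<dots> \<le> pprt s" using ub[OF a] by (auto simp: pprt_mono)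
        finally show "a \<le> pprt s - ?t"
          using order_trans[OF add_right_mono[OF le_pprt]] by (simp only: le_diff_eq)
      qed
      moreover have "0 \<le> pprt s - ?t" by (simp only: diff_ge_0_iff_ge inf_le1)
      ultimately have "pprt s \<le> pprt s - ?t" by (subst pprt_def) (rule sup_least)
      then have "?t \<le> 0" by (simp only: le_diff_eq add_le_same_cancel1)
      then have 1: "?t = 0" by (intro antisym) simp_all
      have "pprt (- s) \<le> pprt (- a)" using ub[OF a] by (simp add: pprt_mono)
      also have "\<dots> \<le> \<bar>a\<bar>" using pprt_le_abs[of "- a"] by simp
      finally have le: "pprt (- s) \<le> \<bar>a\<bar>" .
      have "inf \<bar>a\<bar> \<bar>z\<bar> = 0" using A a by blast
      then have "inf (pprt (- s)) \<bar>z\<bar> = 0" by (rule disjoint_mono[OF _ _ le]) simp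
      with 1 have "inf (pprt s + pprt (- s)) \<bar>z\<bar> = 0" by (rule disjoint_add)
      then show ?thesis by (simp add: abs_prts pprt_neg)
    qed
  qed
  ultimately have "band ?B" unfolding band_def using solid by blast
  then show ?thesis by (simp add: disjoint_complement_def)
qed

lemma weak_order_unit_disjoint_eq_0:
  fixes e :: "'a::riesz_space"
  assumes "weak_order_unit e" "inf x e = 0"
  shows "x = 0"
proof -
  have nn: "0 \<le> x" "0 \<le> e" using assms(2) inf_le1[of x e] inf_le2[of x e] by simp_all
  have "e \<in> disjoint_complement {x}"
    using assms(2) nn by (simp add: disjoint_complement_def inf.commute)
  then have "band hull {e} \<subseteq> disjoint_complement {x}"
    by (intro hull_minimal) (auto simp: disjoint_complement_singleton_band)
  then have "x \<in> disjoint_complement {x}"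
    using assms(1) by (auto simp: weak_order_unit_def)
  then show ?thesis by (simp add: disjoint_complement_def)
qed

text \<open>This is the sense in which the truncations \<open>inf x (n e)\<close> increase to \<open>x\<close>; a common lower bound of
  the remainders meets \<open>e\<close> in an element below \<open>x / n\<close> for every \<open>n\<close>.\<close>

lemma truncation_remainder_decreases_to_zero:
  fixes e x :: "'a::dedekind_complete_riesz_space"
  assumes "weak_order_unit e" "0 \<le> x"
  shows "decreases_to_zero (range (\<lambda>n::nat. pprt (x - real n *\<^sub>R e)))"
proof -
  have e: "0 \<le> e" using assms(1) by (simp add: weak_order_unit_def)
  have dec: "pprt (x - real n *\<^sub>R e) \<le> pprt (x - real m *\<^sub>R e)" if "m \<le> n" for m n :: nat
    using that e by (intro pprt_mono diff_left_mono scaleR_right_mono) auto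
  have "z \<le> 0" if z: "\<And>n::nat. z \<le> pprt (x - real n *\<^sub>R e)" for z
  proof -
    have "inf (pprt z) e \<le> 0"
    proof (rule archimedean)
      fix n :: nat
      have "pprt z \<le> pprt (x - real n *\<^sub>R e)" using pprt_mono[OF z[of n]] by simp
      then have "real n *\<^sub>R inf (pprt z) e \<le> real n *\<^sub>R inf (pprt (x - real n *\<^sub>R e)) e"
        by (intro scaleR_left_mono inf_mono) auto
      also have "\<dots> \<le> x" using assms(2) e by (intro scaleR_inf_pprt_le) auto
      finally show "real n *\<^sub>R inf (pprt z) e \<le> x" .
    qed
    then have "inf (pprt z) e = 0" using e by (intro antisym) auto
    with assms(1) have "pprt z = 0" by (rule weak_order_unit_disjoint_eq_0)
    then show ?thesis using le_pprt[of z] by simp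
  qed
  then have "isGlb UNIV (range (\<lambda>n::nat. pprt (x - real n *\<^sub>R e))) 0"
    by (auto simp: isGlb_def greatestP_def isLb_def setge_def setle_def)
  moreover have "\<exists>k. pprt (x - real k *\<^sub>R e) \<le> pprt (x - real m *\<^sub>R e) 
      \<and> pprt (x - real k *\<^sub>R e) \<le> pprt (x - real n *\<^sub>R e)" for m n :: nat
    using dec[of m "max m n"] dec[of n "max m n"] by auto
  ultimately show ?thesis unfolding decreases_to_zero_def by auto
qed

section \<open>Locality of a conditional expectation\<close>

text \<open>If \<open>x\<close> is disjoint from \<open>y\<close>, then a truncation \<open>inf x (m e)\<close> lies below \<open>pprt (m e - n y)\<close> for
  every \<open>n\<close>. These majorants are built from elements of the range, so \<open>T\<close> fixes them and they also
  dominate the image of the truncation, while their meets with \<open>y\<close> are at most \<open>m e / n\<close>. Order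
  continuity passes from the truncations to \<open>x\<close>.\<close>

lemma conditional_expectation_local:
  fixes T :: "'a::dedekind_complete_riesz_space \<Rightarrow> 'a"
  assumes e: "weak_order_unit e" and T: "conditional_expectation T" and Te: "T e = e"
    and y: "y \<in> range T" and disj: "inf x y = 0"
  shows "inf (T x) y = 0"
proof -
  have pos: "0 \<le> T u" if "0 \<le> u" for u
    using T that by (auto simp: conditional_expectation_def positive_order_continuous_def 
        positive_operator_def)
  have lin: "linear T"
    using T by (auto simp: conditional_expectation_def positive_order_continuous_def 
        positive_operator_def)
  have mono: "T u \<le> T v" if "u \<le> v" for u v
    using pos[of "v - u"] that lin by (simp add: linear_diff)
  have fix_range: "T u = u" if "u \<in> range T" for u
    using T that by (auto simp: conditional_expectation_def)
  have R: "riesz_subspace (range T)" using T by (simp add: conditional_expectation_def)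
  then have S: "subspace (range T)" by (simp add: riesz_subspace_def)
  have eR: "e \<in> range T" using Te by (metis rangeI)
  have e0: "0 \<le> e" using e by (simp add: weak_order_unit_def)
  have nn: "0 \<le> x" "0 \<le> y" using disj inf_le1[of x y] inf_le2[of x y] by simp_all
  have trunc: "inf (T (inf x (m *\<^sub>R e))) y = 0" if m: "0 \<le> m" for m
  proof (rule antisym)
    have me: "0 \<le> m *\<^sub>R e" using m e0 by (simp add: scaleR_nonneg_nonneg)
    show "0 \<le> inf (T (inf x (m *\<^sub>R e))) y" using nn me by (auto intro: pos)
    show "inf (T (inf x (m *\<^sub>R e))) y \<le> 0"
    proof (rule archimedean)
      fix n :: nat
      let ?r = "pprt (m *\<^sub>R e - real n *\<^sub>R y)"
      have "?r \<in> range T"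
        using y eR by (intro riesz_subspace_pprt[OF R] subspace_diff[OF S] subspace_scale[OF S])
      then have Tr: "T ?r = ?r" by (rule fix_range)
      have "inf x (real n *\<^sub>R y) = 0"
        using disjoint_scaleR[of y x "real n"] disj by (simp add: inf.commute)
      moreover have "m *\<^sub>R e \<le> ?r + real n *\<^sub>R y"
        using le_pprt[of "m *\<^sub>R e - real n *\<^sub>R y"] by (simp add: diff_le_eq)
      then have "inf x (m *\<^sub>R e) \<le> inf x (?r + real n *\<^sub>R y)" by (intro inf_mono) auto
      moreover have "\<dots> \<le> inf x ?r + inf x (real n *\<^sub>R y)"
        using nn by (intro inf_add_le) (auto simp: scaleR_nonneg_nonneg)
      ultimately have "inf x (m *\<^sub>R e) \<le> inf x ?r" by (simp only: add_0_right order_trans)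
      then have "inf x (m *\<^sub>R e) \<le> ?r" by simp
      then have "T (inf x (m *\<^sub>R e)) \<le> ?r" using mono Tr by metis
      then have "real n *\<^sub>R inf (T (inf x (m *\<^sub>R e))) y \<le> real n *\<^sub>R inf ?r y"
        by (intro scaleR_left_mono inf_mono) auto
      also have "\<dots> \<le> m *\<^sub>R e" using me nn by (intro scaleR_inf_pprt_le) auto
      finally show "real n *\<^sub>R inf (T (inf x (m *\<^sub>R e))) y \<le> m *\<^sub>R e" .
    qed
  qed
  let ?D = "range (\<lambda>n::nat. pprt (x - real n *\<^sub>R e))"
  have "decreases_to_zero (T ` ?D)"
    using T truncation_remainder_decreases_to_zero[OF e nn(1)]
    by (simp add: conditional_expectation_def positive_order_continuous_def)
  then have glb: "z \<le> 0" if "\<And>n::nat. z \<le> T (pprt (x - real n *\<^sub>R e))" for z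
    using that by (auto simp: decreases_to_zero_def isGlb_def greatestP_def isLb_def 
        setge_def setle_def)
  have "inf (T x) y \<le> 0"
  proof (rule glb)
    fix n :: nat
    let ?u = "inf x (real n *\<^sub>R e)" and ?v = "pprt (x - real n *\<^sub>R e)"
    have sup: "?v + real n *\<^sub>R e = sup x (real n *\<^sub>R e)"
      by (simp add: pprt_def add_sup_distrib_right)
    have "x + real n *\<^sub>R e = ?u + (?v + real n *\<^sub>R e)"
      unfolding sup by (simp only: add_eq_inf_sup[of x] add.commute)
    then have "x = ?u + ?v" by (simp only: add_right_cancel flip: add.assoc)
    then have "T x = T (?u + ?v)" by (rule arg_cong)
    then have "T x = T ?u + T ?v" by (simp only: linear_add[OF lin])
    moreover have "0 \<le> ?u" using nn e0 by (simp add: scaleR_nonneg_nonneg)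
    ultimately have "inf (T x) y \<le> inf y (T ?u) + inf y (T ?v)"
      using inf_add_le[of "T ?u" "T ?v" y] nn(2) by (simp add: inf.commute pos)
    also have "\<dots> = inf y (T ?v)" using trunc[of "real n"] by (simp add: inf.commute)
    finally show "inf (T x) y \<le> T ?v" by simp
  qed
  then show ?thesis using nn by (intro antisym) (auto intro: pos)
qed

section \<open>Comparison of elements by their position relative to multiples of the unit\<close>

text \<open>Reading elements as functions with \<open>e = 1\<close>, the hypotheses say that \<open>a \<le> c b\<close> where \<open>g < c\<close> and
  \<open>a' \<ge> c b\<close> where \<open>g > c\<close>. Let \<open>v\<close> be the positive part of \<open>a - a' - 2 \<epsilon> b\<close>. Where \<open>(k - 1) \<epsilon> < g < (k + 1) \<epsilon>\<close>, the
  hypotheses give \<open>a \<le> (k + 1) \<epsilon> b\<close> and \<open>a' \<ge> (k - 1) \<epsilon> b\<close>, so \<open>v\<close> vanishes there. These overlapping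
  windows, taken in order, remove \<open>v\<close> from each region \<open>g < k \<epsilon>\<close>, and the regions exhaust the space
  by the Archimedean property.\<close>

lemma le_if_level_sets_compatible:
  fixes a a' b e g :: "'a::dedekind_complete_riesz_space"
  assumes e: "0 \<le> e" and unit: "\<And>x. inf x e = 0 \<Longrightarrow> x = 0"
    and g: "0 \<le> g" and b: "0 \<le> b"
    and below: "\<And>c. inf (pprt (a - c *\<^sub>R b)) (pprt (c *\<^sub>R e - g)) = 0"
    and above: "\<And>c. inf (pprt (c *\<^sub>R b - a')) (pprt (g - c *\<^sub>R e)) = 0"
  shows "a \<le> a'"
proof -
  have "a - a' \<le> 0"
  proof (rule le_zero_if_le_scaleR)
    fix r :: real assume "r > 0"
    define \<epsilon> where "\<epsilon> = r / 2"
    have \<epsilon>: "\<epsilon> > 0" and r: "r = 2 * \<epsilon>" using \<open>r > 0\<close> by (auto simp: \<epsilon>_def)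
    have unit': "x = 0" if "inf x (\<epsilon> *\<^sub>R e) = 0" for x
    proof (rule unit)
      show "inf x e = 0"
        using disjoint_scaleR[of "\<epsilon> *\<^sub>R e" x "1 / \<epsilon>"] that \<epsilon> by (simp add: inf.commute)
    qed
    define v where "v = pprt (a - a' - r *\<^sub>R b)"
    have v: "0 \<le> v" by (simp add: v_def)
    have level: "inf v (pprt ((real k * \<epsilon>) *\<^sub>R e - g)) = 0" for k
    proof (induction k)
      case 0
      have "pprt (- g) = 0" using g by (simp add: pprt_def sup_absorb2)
      then show ?case using v by (simp add: inf_absorb2)
    next
      case (Suc k)
      define p where "p = pprt ((real (Suc k) * \<epsilon>) *\<^sub>R e - g)"
      define q where "q = pprt (g - ((real k - 1) * \<epsilon>) *\<^sub>R e)"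
      define l where "l = pprt ((real k * \<epsilon>) *\<^sub>R e - g)"
      define s where "s = pprt (a - (real (Suc k) * \<epsilon>) *\<^sub>R b)"
      define t where "t = pprt (((real k - 1) * \<epsilon>) *\<^sub>R b - a')"
      have nn: "0 \<le> p" "0 \<le> q" "0 \<le> l" "0 \<le> s" "0 \<le> t"
        by (simp_all add: p_def q_def l_def s_def t_def)
      have "a - a' - r *\<^sub>R b 
          = (a - (real (Suc k) * \<epsilon>) *\<^sub>R b) + (((real k - 1) * \<epsilon>) *\<^sub>R b - a')"
        by (simp add: r algebra_simps flip: scaleR_left_distrib)
      then have "v \<le> s + t" unfolding v_def s_def t_def by (metis pprt_add_le)
      moreover have "inf s (inf p q) = 0"
        using disjoint_mono[of p s "inf p q"] below nn
        by (simp add: s_def p_def inf.commute)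
      moreover have "inf t (inf p q) = 0"
        using disjoint_mono[of q t "inf p q"] above nn
        by (simp add: t_def q_def inf.commute)
      ultimately have "inf v (inf p q) = 0"
        using disjoint_add[of s "inf p q" t] disjoint_mono[of "s + t" "inf p q" v] v by simp
      then have vpq: "inf (inf v p) q = 0" by (simp add: inf.assoc)
      have vpl: "inf (inf v p) l = 0"
        using disjoint_mono[of v l "inf v p"] Suc.IH v nn by (simp add: l_def)
      \<comment> \<open>At every point \<open>g < k \<epsilon>\<close> or \<open>g > (k - 1) \<epsilon>\<close>, and the two excesses add up to at least
        \<open>\<epsilon>\<close>, so an element disjoint from both is disjoint from the unit.\<close>
      have "\<epsilon> *\<^sub>R e = ((real k * \<epsilon>) *\<^sub>R e - g) + (g - ((real k - 1) * \<epsilon>) *\<^sub>R e)"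
        by (simp add: algebra_simps)
      then have le: "\<epsilon> *\<^sub>R e \<le> l + q" unfolding l_def q_def by (metis add_mono le_pprt)
      have "inf (l + q) (inf v p) = 0"
        using disjoint_add[of l "inf v p" q] vpl vpq by (simp add: inf.commute)
      then have "inf (inf v p) (\<epsilon> *\<^sub>R e) = 0"
        using disjoint_mono[OF _ _ le] e \<epsilon> by (simp add: inf.commute scaleR_nonneg_nonneg)
      then show ?case unfolding p_def by (rule unit')
    qed
    have "inf v (\<epsilon> *\<^sub>R e) \<le> 0"
    proof (rule archimedean)
      fix k :: nat
      let ?l = "pprt ((real k * \<epsilon>) *\<^sub>R e - g)"
      let ?u = "inf v (\<epsilon> *\<^sub>R e)"
      have "real k *\<^sub>R ?u \<le> real k *\<^sub>R (\<epsilon> *\<^sub>R e)" by (intro scaleR_left_mono) auto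
      also have "\<dots> \<le> ?l + g"
        using le_pprt[of "(real k * \<epsilon>) *\<^sub>R e - g"] by (simp add: diff_le_eq)
      finally have "real k *\<^sub>R ?u \<le> inf (real k *\<^sub>R v) (?l + g)"
        by (simp add: scaleR_left_mono)
      also have "\<dots> \<le> inf (real k *\<^sub>R v) ?l + inf (real k *\<^sub>R v) g"
        using v g by (intro inf_add_le) (auto simp: scaleR_nonneg_nonneg)
      also have "\<dots> \<le> g" using disjoint_scaleR[OF level[of k]] by simp
      finally show "real k *\<^sub>R ?u \<le> g" .
    qed
    then have "inf v (\<epsilon> *\<^sub>R e) = 0"
      using v e \<epsilon> by (intro antisym) (auto simp: scaleR_nonneg_nonneg)
    then have "v = 0" by (rule unit')
    then show "a - a' \<le> r *\<^sub>R b"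
      using le_pprt[of "a - a' - r *\<^sub>R b"] by (simp add: v_def)
  qed (rule b)
  then show ?thesis by simp
qed

section \<open>Products in an f-algebra\<close>

lemma disjoint_mult_eq_0:
  fixes x y :: "'a::f_algebra"
  assumes "inf x y = 0"
  shows "x * y = 0"
proof -
  have nn: "0 \<le> x" "0 \<le> y" using assms inf_le1[of x y] inf_le2[of x y] by simp_all
  have "inf y (x * y) = 0" using f_algebra_right[OF assms nn(2)] by (simp add: inf.commute)
  then have "inf (x * y) (x * y) = 0" using nn(1) by (rule f_algebra_left)
  then show ?thesis by simp
qed

lemma pprt_mult_nonneg_left:
  fixes x y :: "'a::f_algebra"
  assumes "0 \<le> x"
  shows "pprt (x * y) = x * pprt y"
proof -
  have "inf (x * pprt y) (pprt (- y)) = 0"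
    using disjoint_pprt_uminus assms by (rule f_algebra_left)
  then have "inf (x * pprt (- y)) (x * pprt y) = 0"
    using assms by (intro f_algebra_left) (simp_all add: inf.commute)
  then have "pprt (x * pprt y - x * pprt (- y)) = x * pprt y"
    by (intro pprt_diff_disjoint) (simp add: inf.commute)
  then show ?thesis by (simp only: pprt_diff_pprt_uminus flip: right_diff_distrib)
qed

lemma pprt_mult_nonneg_right:
  fixes x y :: "'a::f_algebra"
  assumes "0 \<le> y"
  shows "pprt (x * y) = pprt x * y"
proof -
  have "inf (pprt x * y) (pprt (- x)) = 0"
    by (rule f_algebra_right[OF disjoint_pprt_uminus assms])
  then have "inf (pprt (- x) * y) (pprt x * y) = 0"
    using assms by (intro f_algebra_right) (simp_all add: inf.commute)
  then have "pprt (pprt x * y - pprt (- x) * y) = pprt x * y"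
    by (intro pprt_diff_disjoint) (simp add: inf.commute)
  then show ?thesis by (simp only: pprt_diff_pprt_uminus flip: left_diff_distrib)
qed

text \<open>Expand \<open>x y\<close> into the four products of positive and negative parts. Two of them that enter with
  opposite signs differ in the part of exactly one factor, which makes them disjoint; so no cancellation occurs and \<open>pprt x * pprt y\<close> is dominated by the positive part of \<open>x y\<close>.\<close>

lemma pprt_mult_pprt_le_abs_mult:
  fixes x y :: "'a::f_algebra"
  shows "pprt x * pprt y \<le> \<bar>x * y\<bar>"
proof -
  let ?A = "pprt x * pprt y" and ?B = "pprt (- x) * pprt (- y)"
    and ?C = "pprt x * pprt (- y)" and ?D = "pprt (- x) * pprt y"
  have dx: "inf (pprt x * u) (pprt (- x) * w) = 0" if "0 \<le> u" "0 \<le> w" for u w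
    using f_algebra_right[OF _ that(2), of "pprt (- x)" "pprt x * u"]
      f_algebra_right[OF disjoint_pprt_uminus that(1), of x] by (simp add: inf.commute)
  have dy: "inf (u * pprt y) (w * pprt (- y)) = 0" if "0 \<le> u" "0 \<le> w" for u w
    using f_algebra_left[OF _ that(2), of "pprt (- y)" "u * pprt y"]
      f_algebra_left[OF disjoint_pprt_uminus that(1), of y] by (simp add: inf.commute)
  have "inf (?C + ?D) ?A = 0"
    using dy[of "pprt x" "pprt x"] dx[of "pprt y" "pprt y"]
    by (intro disjoint_add) (simp_all add: inf.commute)
  moreover have "inf (?C + ?D) ?B = 0"
    using dx[of "pprt (- y)" "pprt (- y)"] dy[of "pprt (- x)" "pprt (- x)"]
    by (intro disjoint_add) (simp_all add: inf.commute)
  ultimately have "inf (?A + ?B) (?C + ?D) = 0"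
    by (intro disjoint_add) (simp_all add: inf.commute)
  then have "pprt ((?A + ?B) - (?C + ?D)) = ?A + ?B" by (rule pprt_diff_disjoint)
  moreover have "(?A + ?B) - (?C + ?D) = (pprt x - pprt (- x)) * (pprt y - pprt (- y))"
    by (simp add: algebra_simps)
  ultimately have "pprt (x * y) = ?A + ?B" by (simp add: pprt_diff_pprt_uminus)
  then have "?A \<le> pprt (x * y)" by (simp add: mult_nonneg_nonneg)
  also have "\<dots> \<le> \<bar>x * y\<bar>" by (rule pprt_le_abs)
  finally show ?thesis .
qed

section \<open>Embeddings into the universal completion\<close>

lemma universal_completion_le_iff:
  assumes "universal_completion J"
  shows "J x \<le> J y \<longleftrightarrow> x \<le> y"
proof -
  have inj: "inj J" and inf: "J (inf x y) = inf (J x) (J y)"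
    using assms by (simp_all add: universal_completion_def)
  have "J x \<le> J y \<longleftrightarrow> J (inf x y) = J x" unfolding inf by (rule inf.absorb_iff1)
  also have "\<dots> \<longleftrightarrow> inf x y = x" using inj by (rule inj_eq)
  also have "\<dots> \<longleftrightarrow> x \<le> y" by (rule inf.absorb_iff1[symmetric])
  finally show ?thesis .
qed

lemma universal_completion_pprt:
  assumes "universal_completion J"
  shows "J (pprt x) = pprt (J x)"
proof -
  have "linear J" and sup: "J (sup x 0) = sup (J x) (J 0)"
    using assms by (simp_all add: universal_completion_def)
  then show ?thesis by (simp only: pprt_def linear_0)
qed

text \<open>The preimage of \<open>u\<close> is the supremum \<open>s\<close>, taken in the smaller space, of all \<open>y\<close> with \<open>J y \<le> u\<close>.
  If \<open>J s\<close> exceeded or missed \<open>u\<close>, order density would give a positive \<open>z\<close> inside the gap, and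
  \<open>s - z\<close> would be a smaller upper bound, or \<open>s + z\<close> would belong to the set.\<close>

lemma universal_completion_range_ideal:
  fixes J :: "'a::dedekind_complete_riesz_space \<Rightarrow> 'u::universally_complete_riesz_space"
  assumes J: "universal_completion J" and u: "0 \<le> u" "u \<le> J x"
  shows "u \<in> range J"
proof -
  have lin: "linear J" and dense: "\<And>w. 0 < w \<Longrightarrow> \<exists>y. 0 < J y \<and> J y \<le> w"
    using J by (auto simp: universal_completion_def)
  note le_iff = universal_completion_le_iff[OF J]
  have pos: "0 < z" if "0 < J z" for z
    using that le_iff[of 0 z] linear_0[OF lin] by (auto simp: less_le)
  let ?A = "{y. J y \<le> u}"
  define s where "s = Sup ?A"
  have bdd: "bdd_above ?A" using u(2) le_iff order_trans by (intro bdd_aboveI[of _ x]) blast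
  have "0 \<in> ?A" using u(1) linear_0[OF lin] by simp
  then have least: "s \<le> w" if "\<And>y. J y \<le> u \<Longrightarrow> y \<le> w" for w
    unfolding s_def using that by (intro cSup_least) auto
  have upper: "y \<le> s" if "J y \<le> u" for y
    unfolding s_def using that bdd by (intro cSup_upper) auto
  have "pprt (J s - u) = 0"
  proof (rule ccontr)
    assume "pprt (J s - u) \<noteq> 0"
    then have "0 < pprt (J s - u)" by (simp add: less_le)
    then obtain z where z: "0 < J z" "J z \<le> pprt (J s - u)" using dense by blast
    have "s \<le> s - z"
    proof (rule least)
      fix y assume y: "J y \<le> u"
      have "J y + J z \<le> J y + pprt (J s - u)" using z(2) by simp
      also have "\<dots> \<le> J s"
      proof -
        have "pprt (J s - u) \<le> pprt (J s - J y)" using y by (intro pprt_mono) simp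
        also have "\<dots> = J s - J y"
          using upper[OF y] le_iff[of y s] by (simp add: pprt_eq_id)
        finally show ?thesis by (simp add: le_diff_eq add.commute)
      qed
      finally have "J (y + z) \<le> J s" using lin by (simp add: linear_add)
      then show "y \<le> s - z" using le_iff by (simp add: le_diff_eq)
    qed
    then show False using pos[OF z(1)] by (simp add: le_diff_eq)
  qed
  then have Js: "J s \<le> u" using le_pprt[of "J s - u"] by simp
  have "u = J s"
  proof (rule ccontr)
    assume "u \<noteq> J s"
    then have "0 < u - J s" using Js by (simp add: less_le)
    then obtain z where z: "0 < J z" "J z \<le> u - J s" using dense by blast
    then have "J (z + s) \<le> u" using lin by (simp add: linear_add le_diff_eq)
    then have "z + s \<le> s" by (rule upper)
    then show False using pos[OF z(1)] by simp
  qed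
  then show ?thesis by simp
qed

section \<open>The averaging identity\<close>

text \<open>Both \<open>J (T h)\<close> and \<open>J g * J (T f)\<close> satisfy the hypotheses of \<open>le_if_level_sets_compatible\<close> with
  \<open>b = J (T f)\<close>, the first by locality of \<open>T\<close>, the second directly from the f-algebra property.\<close>

lemma averaging_nonneg:
  fixes J :: "'a::dedekind_complete_riesz_space
                \<Rightarrow> 'u::{universally_complete_riesz_space, f_algebra}"
  assumes e: "weak_order_unit e" and T: "conditional_expectation T" and Te: "T e = e"
    and J: "universal_completion J" and unit: "\<And>x. J e * x = x" "\<And>x. x * J e = x"
    and gR: "g \<in> range T" and h: "J h = J f * J g" and f: "0 \<le> f" and g: "0 \<le> g"
  shows "J (T h) = J g * J (T f)"
proof -
  have linJ: "linear J" and injJ: "inj J" 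
    and infJ: "\<And>x y. J (inf x y) = inf (J x) (J y)"
    using J by (auto simp: universal_completion_def)
  note le_iff = universal_completion_le_iff[OF J] and pprtJ = universal_completion_pprt[OF J]
  have J0: "J 0 = 0" using linJ by (rule linear_0)
  have nnJ: "0 \<le> J x" if "0 \<le> x" for x using le_iff[of 0 x] that J0 by simp
  have linT: "linear T"
    using T by (simp add: conditional_expectation_def positive_order_continuous_def 
        positive_operator_def)
  have posT: "0 \<le> T u" if "0 \<le> u" for u
    using T that by (simp add: conditional_expectation_def positive_order_continuous_def 
        positive_operator_def)
  have R: "riesz_subspace (range T)" using T by (simp add: conditional_expectation_def)
  then have S: "subspace (range T)" by (simp add: riesz_subspace_def)
  have eR: "e \<in> range T" using Te by (metis rangeI)
  have pprtR: "pprt u \<in> range T" if "u \<in> range T" for u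
    using R that by (rule riesz_subspace_pprt)
  have pprt_T_le: "pprt (T u) \<le> T (pprt u)" for u
  proof -
    have "T u \<le> T (pprt u)"
      using posT[of "pprt u - u"] le_pprt[of u] linT by (simp add: linear_diff)
    then show ?thesis by (simp add: pprt_def[of "T u"] posT)
  qed
  define b where "b = J (T f)"
  have b: "0 \<le> b" using f by (simp add: b_def nnJ posT)
  have e0: "0 \<le> J e" using e by (simp add: nnJ weak_order_unit_def)
  have weak: "x = 0" if "inf x (J e) = 0" for x
    using disjoint_mult_eq_0[OF that] unit by simp
  \<comment> \<open>Disjointness from an element of the range of \<open>T\<close> survives the application of \<open>T\<close>, also when
    it is tested in the universal completion.\<close>
  have transfer: "inf (pprt (J (T u))) (pprt (J w)) = 0"
    if "w \<in> range T" and d: "inf (pprt (J u)) (pprt (J w)) = 0" for u w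
  proof -
    have "J (inf (pprt u) (pprt w)) = J 0" using d by (simp add: infJ pprtJ J0)
    then have "inf (pprt u) (pprt w) = 0" using injJ by (simp add: inj_eq)
    then have "inf (T (pprt u)) (pprt w) = 0"
      using conditional_expectation_local[OF e T Te pprtR] that(1) by blast
    then have "inf (pprt (T u)) (pprt w) = 0"
      by (rule disjoint_mono[OF _ _ pprt_T_le]) simp
    then have "J (inf (pprt (T u)) (pprt w)) = J 0" by simp
    then show ?thesis by (simp add: infJ pprtJ J0)
  qed
  have prodL: "inf (pprt (J f * u)) (pprt (- u)) = 0" for u
    unfolding pprt_mult_nonneg_left[OF nnJ[OF f]]
    using disjoint_pprt_uminus nnJ[OF f] by (rule f_algebra_left)
  have prodR: "inf (pprt (u * b)) (pprt (- u)) = 0" for u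
    unfolding pprt_mult_nonneg_right[OF b] using disjoint_pprt_uminus b by (rule f_algebra_right)
  have wR: "c *\<^sub>R e - g \<in> range T" "g - c *\<^sub>R e \<in> range T" for c
    using eR gR by (simp_all add: subspace_diff[OF S] subspace_scale[OF S])
  have Jw: "J (c *\<^sub>R e - g) = c *\<^sub>R J e - J g" "J (g - c *\<^sub>R e) = J g - c *\<^sub>R J e" for c
    using linJ by (simp_all add: linear_diff linear_scale)
  have Tu: "J (T (h - c *\<^sub>R f)) = J (T h) - c *\<^sub>R b" 
    "J (T (c *\<^sub>R f - h)) = c *\<^sub>R b - J (T h)" for c
    using linJ linT by (simp_all add: linear_diff linear_scale b_def)
  have Ju: "J (h - c *\<^sub>R f) = J f * (J g - c *\<^sub>R J e)" 
    "J (c *\<^sub>R f - h) = J f * (c *\<^sub>R J e - J g)" for c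
    using linJ by (simp_all add: linear_diff linear_scale h unit right_diff_distrib)
  have below_T: "inf (pprt (J (T h) - c *\<^sub>R b)) (pprt (c *\<^sub>R J e - J g)) = 0" for c
    using transfer[OF wR(1)[of c], of "h - c *\<^sub>R f"] prodL[of "J g - c *\<^sub>R J e"]
    by (simp add: Tu Ju Jw)
  have above_T: "inf (pprt (c *\<^sub>R b - J (T h))) (pprt (J g - c *\<^sub>R J e)) = 0" for c
    using transfer[OF wR(2)[of c], of "c *\<^sub>R f - h"] prodL[of "c *\<^sub>R J e - J g"]
    by (simp add: Tu Ju Jw)
  have below_mult: "inf (pprt (J g * b - c *\<^sub>R b)) (pprt (c *\<^sub>R J e - J g)) = 0" for c
    using prodR[of "J g - c *\<^sub>R J e"] by (simp add: left_diff_distrib unit)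
  have above_mult: "inf (pprt (c *\<^sub>R b - J g * b)) (pprt (J g - c *\<^sub>R J e)) = 0" for c
    using prodR[of "c *\<^sub>R J e - J g"] by (simp add: left_diff_distrib unit)
  have "J (T h) \<le> J g * b"
    using e0 weak nnJ[OF g] b below_T above_mult by (rule le_if_level_sets_compatible)
  moreover have "J g * b \<le> J (T h)"
    using e0 weak nnJ[OF g] b below_mult above_T by (rule le_if_level_sets_compatible)
  ultimately show ?thesis by (simp add: b_def)
qed

theorem lemma3p1:
  fixes J :: "'a::dedekind_complete_riesz_space
                \<Rightarrow> 'u::{universally_complete_riesz_space, f_algebra}"
    and T :: "'a \<Rightarrow> 'a"
    and e f g h :: 'a
  assumes "weak_order_unit e"
    and "conditional_expectation T"
    and "T e = e"
    and "universal_completion J"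
    and "natural_multiplication (J e)"
    and "g \<in> range T"
    and "J h = J f * J g"
  shows "J g * J (T f) \<in> range J \<and> J (T h) = J g * J (T f)"
proof -
  note J = assms(4)
  have lin: "linear J" using J by (simp add: universal_completion_def)
  have linT: "linear T"
    using assms(2) by (simp add: conditional_expectation_def positive_order_continuous_def 
        positive_operator_def)
  have R: "riesz_subspace (range T)" using assms(2) by (simp add: conditional_expectation_def)
  then have S: "subspace (range T)" by (simp add: riesz_subspace_def)
  have unit: "J e * x = x" "x * J e = x" for x
    using assms(5) by (simp_all add: natural_multiplication_def)
  have absJ: "J \<bar>x\<bar> = \<bar>J x\<bar>" for x
    using J lin by (simp add: universal_completion_def abs_lattice linear_neg)
  \<comment> \<open>Stated for any signs \<open>f' = \<plusminus> f\<close> and \<open>g' = \<plusminus> g\<close>: the product of the positive parts comes from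
    an element \<open>k\<close> of the smaller space, because it is dominated by the image of \<open>\<bar>h\<bar>\<close>.\<close>
  have part: "\<exists>k. J k = J (pprt f') * J (pprt g') \<and> J (T k) = J (pprt g') * J (T (pprt f'))"
    if fg: "\<bar>J f' * J g'\<bar> = J \<bar>h\<bar>" and g': "g' \<in> range T" for f' g'
  proof -
    have "J (pprt f') * J (pprt g') \<in> range J"
    proof (rule universal_completion_range_ideal[OF J])
      show "0 \<le> J (pprt f') * J (pprt g')"
        by (simp add: universal_completion_pprt[OF J] mult_nonneg_nonneg)
      show "J (pprt f') * J (pprt g') \<le> J \<bar>h\<bar>"
        using pprt_mult_pprt_le_abs_mult[of "J f'" "J g'"] fg
        by (simp add: universal_completion_pprt[OF J])
    qed
    then obtain k where k: "J k = J (pprt f') * J (pprt g')" by (metis imageE)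
    have "pprt g' \<in> range T"
      using R g' by (rule riesz_subspace_pprt)
    then have "J (T k) = J (pprt g') * J (T (pprt f'))"
      using averaging_nonneg[OF assms(1,2,3) J unit _ k] by simp
    with k show ?thesis by blast
  qed
  have ng: "- g \<in> range T" using assms(6) by (rule subspace_neg[OF S])
  obtain k1 where k1: "J k1 = J (pprt f) * J (pprt g)" "J (T k1) = J (pprt g) * J (T (pprt f))"
    using part[of f g] assms(6,7) absJ by auto
  obtain k2 where k2: "J k2 = J (pprt (-f)) * J (pprt (-g))" 
      "J (T k2) = J (pprt (-g)) * J (T (pprt (-f)))"
    using part[of "-f" "-g"] ng assms(7) absJ lin by (auto simp: linear_neg)
  obtain k3 where k3: "J k3 = J (pprt f) * J (pprt (-g))" 
      "J (T k3) = J (pprt (-g)) * J (T (pprt f))"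
    using part[of f "-g"] ng assms(7) absJ lin by (auto simp: linear_neg)
  obtain k4 where k4: "J k4 = J (pprt (-f)) * J (pprt g)" 
      "J (T k4) = J (pprt g) * J (T (pprt (-f)))"
    using part[of "-f" g] assms(6,7) absJ lin by (auto simp: linear_neg)
  have f: "f = pprt f - pprt (- f)" and g: "g = pprt g - pprt (- g)"
    by (simp_all only: pprt_diff_pprt_uminus)
  have Jf: "J f = J (pprt f) - J (pprt (- f))" and Jg: "J g = J (pprt g) - J (pprt (- g))"
    and JTf: "J (T f) = J (T (pprt f)) - J (T (pprt (- f)))"
    using lin linT f g by (metis linear_diff)+
  have "J h = J (k1 + k2 - k3 - k4)"
    unfolding assms(7) Jf Jg using lin by (simp add: linear_diff linear_add k1 k2 k3 k4 algebra_simps)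
  then have "h = k1 + k2 - k3 - k4" using J by (auto simp: universal_completion_def inj_eq)
  then have "J (T h) = J (T (k1 + k2 - k3 - k4))" by (simp only:)
  also have "\<dots> = J g * J (T f)"
    unfolding JTf Jg using lin linT by (simp add: linear_diff linear_add k1 k2 k3 k4 algebra_simps)
  finally show ?thesis by (metis rangeI)
qed

end
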